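(* Let $(X,\mathcal{A},\lambda)$ and $(X',\mathcal{A}',\lambda')$ be $\sigma$-finite measure spaces and $T:X\to X'$ a null-preserving map. Then the following hold. (i) Every $A\in\mathcal{A}$ possesses an essential image $\hat{T}A$ under $T$, and the essential images of $A$ form an equivalence class under $\overset{.}{=}$. (ii) For $A\in\mathcal{A}$ and $A'\in\mathcal{A}'$: $\lambda(A)>0$ iff $\lambda'(\hat{T}A)>0$; and $\lambda(T^{-1}A')>0$ iff $\lambda'(\hat{T}X\cap A')>0$. (iii) For $A,B\in\mathcal{A}$ and $A',B'\in\mathcal{A}'$: (a) $A\overset{.}{\subseteq}B$ implies $\hat{T}A\overset{.}{\subseteq}\hat{T}B$; (b) $A\overset{.}{=}B$ implies $\hat{T}A\overset{.}{=}\hat{T}B$; (c) $A\overset{.}{\subseteq}T^{-1}B'$ iff $\hat{T}A\overset{.}{\subseteq}B'$; (d) $A\overset{.}{=}T^{-1}B'$ implies $A\overset{.}{=}T^{-1}\hat{T}A$; (e) $T^{-1}A'\overset{.}{\subseteq}T^{-1}B'$ iff $\hat{T}X\cap A'\overset{.}{\subseteq}\hat{T}X\cap B'$; (f) there exists $M'\in\mathcal{A}'$ with $A\overset{.}{\subseteq}T^{-1}M'$ and $B\overset{.}{\subseteq}(T^{-1}M')^c$ iff $\hat{T}A\cap\hat{T}B\overset{.}{=}\varnothing$. (iv) For $A\in\mathcal{A}$ and $B'\in\mathcal{A}'$: $T^{-1}\hat{T}A\overset{.}{\supseteq}A$; $T^{-1}(\hat{T}X\cap B')\overset{.}{=}T^{-1}B'$;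 $\hat{T}T^{-1}B'\overset{.}{=}\hat{T}X\cap B'$; and $\hat{T}(A\cap T^{-1}B')\overset{.}{=}\hat{T}A\cap B'$. (v) For any $A_n\in\mathcal{A}$, $n\ge 1$: $\hat{T}\left(\bigcup_{n\ge1}A_n\right)\overset{.}{=}\bigcup_{n\ge1}\hat{T}A_n$ and $\hat{T}\left(\bigcap_{n\ge1}A_n\right)\overset{.}{\subseteq}\bigcap_{n\ge1}\hat{T}A_n$. (vi) If $(X'',\mathcal{A}'',\lambda'')$ is a $\sigma$-finite measure space and $T':X'\to X''$ is null-preserving (with respect to $\lambda'$ and $\lambda''$), then $\widehat{(T'\circ T)}A\overset{.}{=}\hat{T}'\hat{T}A$ for every $A\in\mathcal{A}$. Hence, if $(X,\mathcal{A},\lambda)=(X',\mathcal{A}',\lambda')$, then $\widehat{T^n}A\overset{.}{=}\hat{T}^nA$ for $A\in\mathcal{A}$ and $n\ge1$. (vii) If $T_\circ:X\to X'$ is another null-preserving map (with respect to $\lambda$ and $\lambda'$) and $A\in\mathcal{A}$, then $T=T_\circ$ a.e. on $A$ implies $\hat{T}A\overset{.}{=}\hat{T}_\circ A$. In particular, if $T=T_\circ$ a.e. on $X$, then $\hat{T}A\overset{.}{=}\hat{T}_\circ A$ for all $A\in\mathcal{A}$. (viii) If $\lambda$ or $\lambda'$ is replaced by an equivalent $\sigma$-finite measure, then the essential images of any $A\in\mathcal{A}$ remain the same. (ix) For any measurable function $u:X\to[0,\infty)$, $\hat{T}\{u>0\}\overset{.}{=}\{L_Tu>0\}$, where $L_T$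 denotes the transfer operator of $T$.
   Context: In a measure space $(X,\mathcal{A},\lambda)$ write, for $A,B\in\mathcal{A}$, $A\overset{.}{\subseteq}B$ if $\lambda(A\setminus B)=0$ and $A\overset{.}{=}B$ if $\lambda(A\triangle B)=0$ (similarly in the other spaces with their respective measures). Two measures are equivalent if they are mutually absolutely continuous. A measurable map $T:X\to X'$ is null-preserving (w.r.t. $\lambda$ and $\lambda'$) if $\lambda\circ T^{-1}\ll\lambda'$. An essential image of $A\in\mathcal{A}$ under a measurable map $T:X\to X'$ is a set $A'\in\mathcal{A}'$ such that $T^{-1}A'\overset{.}{\supseteq}A$ and such that every $B'\in\mathcal{A}'$ with $T^{-1}B'\overset{.}{\supseteq}A$ satisfies $B'\overset{.}{\supseteq}A'$. $\hat{T}A$ denotes an arbitrary essential image of $A$, fixed for the statement in which it occurs; $\hat T^n$ denotes the $n$-fold iterate. Transfer operator: for $u\in\mathcal{L}_1(\lambda)$ let $\nu$ be the (signed) measure with density $u$ w.r.t. $\lambda$; $L_Tu$ is any version of the density of $\nu\circ T^{-1}$ w.r.t. $\lambda'$. For a measurable, possibly non-integrable $u:X\to[0,\infty)$ the definition extends in the obvious (monotone) way: $L_Tu$ is a measurable $[0,\infty]$-valued function with $\int_{T^{-1}B'}u\,d\lambda=\int_{B'}L_Tu\,d\lambda'$ for all $B'\in\mathcal{A}'$. *)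

theory Defs
  imports "HOL-Analysis.Analysis"
begin

definition ae_subset :: "'a measure \<Rightarrow> 'a set \<Rightarrow> 'a set \<Rightarrow> bool" where
  "ae_subset M A B \<longleftrightarrow> A - B \<in> null_sets M"

definition ae_eq :: "'a measure \<Rightarrow> 'a set \<Rightarrow> 'a set \<Rightarrow> bool" where
  "ae_eq M A B \<longleftrightarrow> (A - B) \<union> (B - A) \<in> null_sets M"

definition ae_eq_rel :: "'a measure \<Rightarrow> ('a set \<times> 'a set) set" where
  "ae_eq_rel M = {(A, B). A \<in> sets M \<and> B \<in> sets M \<and> ae_eq M A B}"

lemma equiv_ae_eq_rel: "equiv (sets M) (ae_eq_rel M)"
proof (rule equivI)
  show "ae_eq_rel M \<subseteq> sets M \<times> sets M"
    by (auto simp: ae_eq_rel_def)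
  show "refl_on (sets M) (ae_eq_rel M)"
    by (auto simp: refl_on_def ae_eq_rel_def ae_eq_def)
  show "sym (ae_eq_rel M)"
    by (auto simp: sym_def ae_eq_rel_def ae_eq_def Un_commute)
  show "trans (ae_eq_rel M)"
  proof (rule transI)
    fix A B C assume *: "(A, B) \<in> ae_eq_rel M" "(B, C) \<in> ae_eq_rel M"
    let ?U = "((A - B) \<union> (B - A)) \<union> ((B - C) \<union> (C - B))"
    have "?U \<in> null_sets M"
      using * unfolding ae_eq_rel_def ae_eq_def by (blast intro: null_sets.Un)
    moreover have "(A - C) \<union> (C - A) \<in> sets M"
      using * by (auto simp: ae_eq_rel_def)
    moreover have "(A - C) \<union> (C - A) \<subseteq> ?U"
      by blast
    ultimately have "(A - C) \<union> (C - A) \<in> null_sets M"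
      by (rule null_sets_subset)
    with * show "(A, C) \<in> ae_eq_rel M"
      by (simp add: ae_eq_rel_def ae_eq_def)
  qed
qed

text \<open>In \<^const>\<open>absolutely_continuous\<close> the dominating measure comes first.\<close>

definition null_preserving :: "'a measure \<Rightarrow> 'b measure \<Rightarrow> ('a \<Rightarrow> 'b) \<Rightarrow> bool" where
  "null_preserving M N T \<longleftrightarrow> T \<in> measurable M N \<and> absolutely_continuous N (distr M N T)"

definition equivalent_measures :: "'a measure \<Rightarrow> 'a measure \<Rightarrow> bool" where
  "equivalent_measures M N \<longleftrightarrow>
     sets M = sets N \<and> absolutely_continuous M N \<and> absolutely_continuous N M"

definition essential_image ::
  "'a measure \<Rightarrow> 'b measure \<Rightarrow> ('a \<Rightarrow> 'b) \<Rightarrow> 'a set \<Rightarrow> 'b set \<Rightarrow> bool" where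
  "essential_image M N T A A' \<longleftrightarrow>
     A' \<in> sets N \<and> ae_subset M A (T -` A' \<inter> space M) \<and>
     (\<forall>B'\<in>sets N. ae_subset M A (T -` B' \<inter> space M) \<longrightarrow> ae_subset N A' B')"

text \<open>An arbitrary selection \<open>A \<mapsto> Th A\<close> of essential images, one for each measurable set;
  its values outside the sigma-algebra are irrelevant.\<close>

definition essential_image_choice ::
  "'a measure \<Rightarrow> 'b measure \<Rightarrow> ('a \<Rightarrow> 'b) \<Rightarrow> ('a set \<Rightarrow> 'b set) \<Rightarrow> bool" where
  "essential_image_choice M N T Th \<longleftrightarrow> (\<forall>A\<in>sets M. essential_image M N T A (Th A))"

text \<open>\<open>v\<close> is a version of the transfer operator of \<open>T\<close> applied to the nonnegative,
  possibly non-integrable function \<open>u\<close>.\<close>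

definition transfer_version ::
  "'a measure \<Rightarrow> 'b measure \<Rightarrow> ('a \<Rightarrow> 'b) \<Rightarrow> ('a \<Rightarrow> real) \<Rightarrow> ('b \<Rightarrow> ennreal) \<Rightarrow> bool" where
  "transfer_version M N T u v \<longleftrightarrow>
     v \<in> borel_measurable N \<and>
     (\<forall>B'\<in>sets N. (\<integral>\<^sup>+x\<in>T -` B' \<inter> space M. ennreal (u x) \<partial>M) = (\<integral>\<^sup>+y\<in>B'. v y \<partial>N))"

lemma transfer_version_exists:
  assumes "sigma_finite_measure N" and "null_preserving M N T"
    and u: "u \<in> borel_measurable M"
  shows "\<exists>v. transfer_version M N T u v"
proof -
  interpret N: sigma_finite_measure N by fact
  let ?D = "density M (\<lambda>x. ennreal (u x))"
  have T: "T \<in> measurable M N" and ac: "absolutely_continuous N (distr M N T)"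
    using assms(2) by (auto simp: null_preserving_def)
  have T': "T \<in> measurable ?D N"
    using T by simp
  have e: "emeasure (distr ?D N T) B = (\<integral>\<^sup>+x\<in>T -` B \<inter> space M. ennreal (u x) \<partial>M)"
    if "B \<in> sets N" for B
    using that T T' u by (simp add: emeasure_distr emeasure_density measurable_sets)
  have "absolutely_continuous N (distr ?D N T)"
    unfolding absolutely_continuous_def
  proof
    fix B assume B: "B \<in> null_sets N"
    then have "B \<in> null_sets (distr M N T)"
      using ac by (auto simp: absolutely_continuous_def)
    then have nz: "T -` B \<inter> space M \<in> null_sets M"
      using T by (simp add: null_sets_distr_iff)
    have "(\<integral>\<^sup>+x\<in>T -` B \<inter> space M. ennreal (u x) \<partial>M) = 0"
      using nz by (simp add: nn_integral_null_set)
    with B e show "B \<in> null_sets (distr ?D N T)"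
      by (auto simp: null_sets_def)
  qed
  then obtain v where v: "v \<in> borel_measurable N" "density N v = distr ?D N T"
    using N.Radon_Nikodym[of "distr ?D N T"] by (metis sets_distr)
  have "transfer_version M N T u v"
    unfolding transfer_version_def
    using v(1) e by (simp add: v(2)[symmetric] emeasure_density)
  then show ?thesis by blast
qed

end

theory Submission
  imports Defs
begin

text \<open>An essential image is a left adjoint of \<open>T\<^sup>-\<^sup>1\<close> modulo null sets: for null-preserving \<open>T\<close>,
  \<open>A'\<close> is an essential image of \<open>A\<close> iff, for all measurable \<open>B'\<close>, almost every point of \<open>A\<close> is
  mapped into \<open>B'\<close> exactly when almost every point of \<open>A'\<close> lies in \<open>B'\<close>. All the calculus
  rules are formal consequences of this adjunction. Existence comes from the transfer operator: the
  two sides of its defining identity vanish simultaneously, so \<open>{v > 0}\<close> is an essential image of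
  \<open>{u > 0}\<close> whenever \<open>v\<close> is a version of the transfer operator applied to \<open>u\<close>.\<close>

section \<open>Inclusion, equality and positivity modulo null sets as almost-everywhere
  statements\<close>

lemma ae_subset_iff_AE:
  assumes "A \<in> sets M" "B \<in> sets M"
  shows "ae_subset M A B \<longleftrightarrow> (AE x in M. x \<in> A \<longrightarrow> x \<in> B)"
proof -
  have "{x \<in> space M. \<not> (x \<in> A \<longrightarrow> x \<in> B)} = A - B"
    using assms sets.sets_into_space by blast
  with assms show ?thesis
    using AE_iff_null[of M "\<lambda>x. x \<in> A \<longrightarrow> x \<in> B"] by (simp add: ae_subset_def sets.Diff)
qed

lemma ae_subset_vimage_iff_AE:
  assumes "T \<in> measurable M N" "A \<in> sets M" "B' \<in> sets N"
  shows "ae_subset M A (T -` B' \<inter> space M) \<longleftrightarrow> (AE x in M. x \<in> A \<longrightarrow> T x \<in> B')"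
proof -
  have "ae_subset M A (T -` B' \<inter> space M) \<longleftrightarrow> (AE x in M. x \<in> A \<longrightarrow> x \<in> T -` B' \<inter> space M)"
    using assms by (intro ae_subset_iff_AE) (auto intro: measurable_sets)
  also have "\<dots> \<longleftrightarrow> (AE x in M. x \<in> A \<longrightarrow> T x \<in> B')"
    by (rule AE_cong) auto
  finally show ?thesis .
qed

text \<open>\<open>null_sets\<close> contains only measurable sets; the hypotheses make the
  one-sided differences measurable, so they inherit nullness from the symmetric difference.\<close>

lemma ae_eq_iff_ae_subset:
  assumes "A \<in> sets M" "B \<in> sets M"
  shows "ae_eq M A B \<longleftrightarrow> ae_subset M A B \<and> ae_subset M B A"
  unfolding ae_eq_def ae_subset_def
  using assms null_sets_subset[of "(A - B) \<union> (B - A)" M] by (auto intro: null_sets.Un)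

lemma ae_eq_iff_AE:
  assumes "A \<in> sets M" "B \<in> sets M"
  shows "ae_eq M A B \<longleftrightarrow> (AE x in M. x \<in> A \<longleftrightarrow> x \<in> B)"
  using assms by (auto simp: ae_eq_iff_ae_subset ae_subset_iff_AE elim: eventually_elim2)

lemma emeasure_pos_iff_AE:
  assumes "A \<in> sets M"
  shows "0 < emeasure M A \<longleftrightarrow> \<not> (AE x in M. x \<notin> A)"
  using assms by (simp add: AE_iff_null_sets[symmetric] null_sets_def zero_less_iff_neq_zero)

section \<open>Pulling almost-everywhere statements back along null-preserving maps\<close>

lemma null_preserving_measurable: "null_preserving M N T \<Longrightarrow> T \<in> measurable M N"
  by (simp add: null_preserving_def)

lemma null_preserving_AE:
  assumes "null_preserving M N T" "AE y in N. P y"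
  shows "AE x in M. P (T x)"
proof -
  \<comment> \<open>The exceptional set of \<open>P\<close> may fail to be measurable, so a
    measurable null cover \<open>Z\<close> of it is pulled back instead.\<close>
  from assms(2) obtain Z where Z: "{y \<in> space N. \<not> P y} \<subseteq> Z" "Z \<in> null_sets N"
    by (auto simp: eventually_ae_filter)
  have T: "T \<in> measurable M N"
    using assms(1) by (rule null_preserving_measurable)
  have "T -` Z \<inter> space M \<in> null_sets M"
    using assms(1) Z(2) T
    by (auto simp: null_preserving_def absolutely_continuous_def null_sets_distr_iff)
  then show ?thesis
    by (rule AE_I') (use Z(1) measurable_space[OF T] in auto)
qed

section \<open>The adjunction between essential images and preimages\<close>

lemma essential_image_sets: "essential_image M N T A A' \<Longrightarrow> A' \<in> sets N"
  by (simp add: essential_image_def)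

text \<open>Choosing \<open>B' = A'\<close> makes the right side of \<open>adj\<close> trivial, so
  its left side is the covering condition; the forward half of \<open>adj\<close> is
  minimality.\<close>

lemma essential_imageI:
  assumes T: "T \<in> measurable M N" and A: "A \<in> sets M" and A': "A' \<in> sets N"
    and adj: "\<And>B'. B' \<in> sets N \<Longrightarrow>
      (AE x in M. x \<in> A \<longrightarrow> T x \<in> B') \<longleftrightarrow> (AE y in N. y \<in> A' \<longrightarrow> y \<in> B')"
  shows "essential_image M N T A A'"
  unfolding essential_image_def
  using A' adj by (simp add: ae_subset_vimage_iff_AE[OF T A] ae_subset_iff_AE)

text \<open>Left to right is minimality. Right to left uses null preservation to pull the inclusion
  of \<open>A'\<close> in \<open>B'\<close> back along \<open>T\<close>, and chains it with the
  covering of \<open>A\<close> by the preimage of \<open>A'\<close>.\<close>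

lemma essential_image_adjunction:
  assumes np: "null_preserving M N T" and ei: "essential_image M N T A A'"
    and A: "A \<in> sets M" and B': "B' \<in> sets N"
  shows "(AE x in M. x \<in> A \<longrightarrow> T x \<in> B') \<longleftrightarrow> (AE y in N. y \<in> A' \<longrightarrow> y \<in> B')"
proof
  note T = null_preserving_measurable[OF np]
  note A' = essential_image_sets[OF ei]
  show "AE y in N. y \<in> A' \<longrightarrow> y \<in> B'" if "AE x in M. x \<in> A \<longrightarrow> T x \<in> B'"
    using ei that B' A'
    by (simp add: essential_image_def ae_subset_vimage_iff_AE[OF T A] ae_subset_iff_AE)
  assume "AE y in N. y \<in> A' \<longrightarrow> y \<in> B'"
  then have "AE x in M. T x \<in> A' \<longrightarrow> T x \<in> B'"
    by (rule null_preserving_AE[OF np])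
  moreover have "AE x in M. x \<in> A \<longrightarrow> T x \<in> A'"
    using ei A' by (simp add: essential_image_def ae_subset_vimage_iff_AE[OF T A])
  ultimately show "AE x in M. x \<in> A \<longrightarrow> T x \<in> B'"
    by eventually_elim auto
qed

text \<open>The unit of the adjunction, obtained from \<open>B' = A'\<close>.\<close>

lemma essential_image_AE:
  assumes "null_preserving M N T" "essential_image M N T A A'" "A \<in> sets M"
  shows "AE x in M. x \<in> A \<longrightarrow> T x \<in> A'"
  using assms essential_image_adjunction[OF assms essential_image_sets[OF assms(2)]] by simp

section \<open>Uniqueness and existence of essential images\<close>

lemma essential_image_unique:
  assumes "essential_image M N T A A'" "essential_image M N T A A''"
  shows "ae_eq N A' A''"
  using assms by (simp add: essential_image_def ae_eq_iff_ae_subset)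

lemma essential_image_ae_eq:
  assumes np: "null_preserving M N T" and ei: "essential_image M N T A A'" and A: "A \<in> sets M"
    and A'': "A'' \<in> sets N" and eq: "ae_eq N A' A''"
  shows "essential_image M N T A A''"
proof (rule essential_imageI[OF null_preserving_measurable[OF np] A A''])
  fix B' assume B': "B' \<in> sets N"
  have "AE y in N. y \<in> A' \<longleftrightarrow> y \<in> A''"
    using eq A'' essential_image_sets[OF ei] by (simp add: ae_eq_iff_AE)
  then have "(AE y in N. y \<in> A' \<longrightarrow> y \<in> B') \<longleftrightarrow> (AE y in N. y \<in> A'' \<longrightarrow> y \<in> B')"
    by (auto elim: eventually_elim2)
  then show "(AE x in M. x \<in> A \<longrightarrow> T x \<in> B') \<longleftrightarrow> (AE y in N. y \<in> A'' \<longrightarrow> y \<in> B')"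
    by (simp add: essential_image_adjunction[OF np ei A B'])
qed

lemma essential_image_transfer:
  assumes np: "null_preserving M N T" and u: "u \<in> borel_measurable M"
    and tv: "transfer_version M N T u v"
  shows "essential_image M N T {x \<in> space M. 0 < u x} {y \<in> space N. 0 < v y}"
proof (rule essential_imageI[OF null_preserving_measurable[OF np]])
  note T = null_preserving_measurable[OF np]
  have v [measurable]: "v \<in> borel_measurable N"
    using tv by (simp add: transfer_version_def)
  note T [measurable] u [measurable]
  show "{x \<in> space M. 0 < u x} \<in> sets M" by measurable
  show "{y \<in> space N. 0 < v y} \<in> sets N" by measurable
  fix B' assume B' [measurable]: "B' \<in> sets N"
  \<comment> \<open>The integral over the preimage of \<open>C\<close> detects the part of
    \<open>{u > 0}\<close> that is mapped outside \<open>B'\<close>, so the transfer identity is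
    applied to the complement of \<open>B'\<close>.\<close>
  define C where "C = space N - B'"
  have C [measurable]: "C \<in> sets N" by (simp add: C_def)
  have TC [measurable]: "T -` C \<inter> space M \<in> sets M"
    using T C by (rule measurable_sets)
  \<comment> \<open>\<open>ennreal\<close> sends negative reals to 0, so the integrand vanishes at a
    point of the preimage of \<open>C\<close> exactly when \<open>u x \<le> 0\<close> there.\<close>
  have "(AE x in M. x \<in> {x \<in> space M. 0 < u x} \<longrightarrow> T x \<in> B') \<longleftrightarrow>
      (AE x in M. ennreal (u x) * indicator (T -` C \<inter> space M) x = 0)"
    using measurable_space[OF T]
    by (intro AE_cong) (auto simp: C_def indicator_def ennreal_eq_0_iff not_less)
  also have "\<dots> \<longleftrightarrow> (\<integral>\<^sup>+x\<in>T -` C \<inter> space M. ennreal (u x) \<partial>M) = 0"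
    by (subst nn_integral_0_iff_AE) simp_all
  also have "\<dots> \<longleftrightarrow> (\<integral>\<^sup>+y\<in>C. v y \<partial>N) = 0"
    using tv C by (simp add: transfer_version_def)
  also have "\<dots> \<longleftrightarrow> (AE y in N. v y * indicator C y = 0)"
    by (subst nn_integral_0_iff_AE) simp_all
  also have "\<dots> \<longleftrightarrow> (AE y in N. y \<in> {y \<in> space N. 0 < v y} \<longrightarrow> y \<in> B')"
    by (intro AE_cong) (auto simp: C_def indicator_def zero_less_iff_neq_zero)
  finally show "(AE x in M. x \<in> {x \<in> space M. 0 < u x} \<longrightarrow> T x \<in> B') \<longleftrightarrow>
      (AE y in N. y \<in> {y \<in> space N. 0 < v y} \<longrightarrow> y \<in> B')" .
qed

text \<open>The indicator of \<open>A\<close> has \<open>A\<close> as its positivity set. It may be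
  non-integrable, which \<open>transfer_version\<close> permits; sigma-finiteness of
  \<open>N\<close> yields the density through Radon-Nikodym.\<close>

lemma essential_image_exists:
  assumes "sigma_finite_measure N" "null_preserving M N T" "A \<in> sets M"
  shows "\<exists>A'. essential_image M N T A A'"
proof -
  have u: "(indicator A :: _ \<Rightarrow> real) \<in> borel_measurable M"
    using assms(3) by simp
  then obtain v where "transfer_version M N T (indicator A) v"
    using transfer_version_exists[OF assms(1,2)] by blast
  from essential_image_transfer[OF assms(2) u this]
  have "essential_image M N T {x \<in> space M. 0 < (indicator A x :: real)} {y \<in> space N. 0 < v y}" .
  moreover have "{x \<in> space M. 0 < (indicator A x :: real)} = A"
    using sets.sets_into_space[OF assms(3)] by (auto simp: indicator_def)
  ultimately show ?thesis by auto
qed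

lemma essential_images_quotient:
  assumes "sigma_finite_measure N" "null_preserving M N T" "A \<in> sets M"
  shows "{A'. essential_image M N T A A'} \<in> sets N // ae_eq_rel N"
proof -
  obtain A' where A': "essential_image M N T A A'"
    using essential_image_exists[OF assms] by blast
  \<comment> \<open>Uniqueness gives the inclusion from left to right; the converse is invariance
    under changes on \<open>N\<close>-null sets.\<close>
  have "{A''. essential_image M N T A A''} = ae_eq_rel N `` {A'}"
    using A' essential_image_sets essential_image_unique essential_image_ae_eq[OF assms(2) A' assms(3)]
    by (fastforce simp: ae_eq_rel_def)
  then show ?thesis
    using essential_image_sets[OF A'] by (auto simp: quotient_def)
qed

section \<open>Positivity, monotonicity, set operations and separation\<close>

lemma essential_image_pos_iff:
  assumes np: "null_preserving M N T" and ei: "essential_image M N T A A'" and A: "A \<in> sets M"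
  shows "0 < emeasure M A \<longleftrightarrow> 0 < emeasure N A'"
  \<comment> \<open>With \<open>B' = {}\<close> the adjunction says that \<open>A\<close> is null
    exactly when \<open>A'\<close> is.\<close>
  using essential_image_adjunction[OF np ei A, of "{}"]
  by (simp add: emeasure_pos_iff_AE A essential_image_sets[OF ei])

lemma essential_image_mono:
  assumes np: "null_preserving M N T"
    and A: "A \<in> sets M" "essential_image M N T A A'"
    and B: "B \<in> sets M" "essential_image M N T B B'"
    and sub: "ae_subset M A B"
  shows "ae_subset N A' B'"
proof -
  note A' = essential_image_sets[OF A(2)] and B' = essential_image_sets[OF B(2)]
  have "AE x in M. x \<in> A \<longrightarrow> x \<in> B"
    using sub A(1) B(1) by (simp add: ae_subset_iff_AE)
  with essential_image_AE[OF np B(2,1)] have "AE x in M. x \<in> A \<longrightarrow> T x \<in> B'"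
    by eventually_elim auto
  then show ?thesis
    by (simp add: essential_image_adjunction[OF np A(2,1) B'] ae_subset_iff_AE A' B')
qed

text \<open>The Frobenius law of the adjunction: the premise that \<open>T x\<close> lies in
  \<open>B'\<close> moves into the conclusion, where it becomes a union with the complement of
  \<open>B'\<close>. After the adjunction for \<open>A\<close> has been applied, the move is undone
  in \<open>N\<close>.\<close>

lemma essential_image_Int_vimage:
  assumes np: "null_preserving M N T" and ei: "essential_image M N T A A'"
    and A: "A \<in> sets M" and B': "B' \<in> sets N"
  shows "essential_image M N T (A \<inter> (T -` B' \<inter> space M)) (A' \<inter> B')"
proof (rule essential_imageI[OF null_preserving_measurable[OF np]])
  note T = null_preserving_measurable[OF np]
  show "A \<inter> (T -` B' \<inter> space M) \<in> sets M"
    using A measurable_sets[OF T B'] by blast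
  show "A' \<inter> B' \<in> sets N"
    using essential_image_sets[OF ei] B' by blast
  fix C assume C: "C \<in> sets N"
  have "(AE x in M. x \<in> A \<inter> (T -` B' \<inter> space M) \<longrightarrow> T x \<in> C) \<longleftrightarrow>
      (AE x in M. x \<in> A \<longrightarrow> T x \<in> (space N - B') \<union> C)"
    using measurable_space[OF T] by (intro AE_cong) auto
  also have "\<dots> \<longleftrightarrow> (AE y in N. y \<in> A' \<longrightarrow> y \<in> (space N - B') \<union> C)"
    using B' C by (intro essential_image_adjunction[OF np ei A]) auto
  also have "\<dots> \<longleftrightarrow> (AE y in N. y \<in> A' \<inter> B' \<longrightarrow> y \<in> C)"
    by (intro AE_cong) auto
  finally show "(AE x in M. x \<in> A \<inter> (T -` B' \<inter> space M) \<longrightarrow> T x \<in> C) \<longleftrightarrow>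
      (AE y in N. y \<in> A' \<inter> B' \<longrightarrow> y \<in> C)" .
qed

lemma essential_image_vimage:
  assumes np: "null_preserving M N T" and ei: "essential_image M N T (space M) X'"
    and B': "B' \<in> sets N"
  shows "essential_image M N T (T -` B' \<inter> space M) (X' \<inter> B')"
  using essential_image_Int_vimage[OF np ei sets.top B'] by (simp add: Int_absorb1)

text \<open>A left adjoint preserves joins; countability of \<open>I\<close> lets the
  almost-everywhere quantifier commute with \<open>\<forall>i\<in>I\<close>.\<close>

lemma essential_image_UN:
  assumes np: "null_preserving M N T" and I: "countable I"
    and A: "\<And>i. i \<in> I \<Longrightarrow> A i \<in> sets M"
    and ei: "\<And>i. i \<in> I \<Longrightarrow> essential_image M N T (A i) (A' i)"
  shows "essential_image M N T (\<Union>i\<in>I. A i) (\<Union>i\<in>I. A' i)"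
proof (rule essential_imageI[OF null_preserving_measurable[OF np]])
  show "(\<Union>i\<in>I. A i) \<in> sets M" "(\<Union>i\<in>I. A' i) \<in> sets N"
    using A essential_image_sets[OF ei] I by (auto intro: sets.countable_UN')
  fix B' assume B': "B' \<in> sets N"
  have "(AE x in M. x \<in> (\<Union>i\<in>I. A i) \<longrightarrow> T x \<in> B') \<longleftrightarrow> (AE x in M. \<forall>i\<in>I. x \<in> A i \<longrightarrow> T x \<in> B')"
    by (intro AE_cong) auto
  also have "\<dots> \<longleftrightarrow> (\<forall>i\<in>I. AE x in M. x \<in> A i \<longrightarrow> T x \<in> B')"
    using I by (rule AE_ball_countable)
  also have "\<dots> \<longleftrightarrow> (\<forall>i\<in>I. AE y in N. y \<in> A' i \<longrightarrow> y \<in> B')"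
    using essential_image_adjunction[OF np ei A B'] by simp
  also have "\<dots> \<longleftrightarrow> (AE y in N. \<forall>i\<in>I. y \<in> A' i \<longrightarrow> y \<in> B')"
    using I by (rule AE_ball_countable[symmetric])
  also have "\<dots> \<longleftrightarrow> (AE y in N. y \<in> (\<Union>i\<in>I. A' i) \<longrightarrow> y \<in> B')"
    by (intro AE_cong) auto
  finally show "(AE x in M. x \<in> (\<Union>i\<in>I. A i) \<longrightarrow> T x \<in> B') \<longleftrightarrow>
      (AE y in N. y \<in> (\<Union>i\<in>I. A' i) \<longrightarrow> y \<in> B')" .
qed

text \<open>Only one inclusion survives for meets, since disjoint sets may be mapped to the same
  place. \<open>I \<noteq> {}\<close> excludes the empty intersection \<open>UNIV\<close>, which may
  be non-measurable.\<close>

lemma essential_image_INT_subset: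
  assumes np: "null_preserving M N T" and I: "countable I" "I \<noteq> {}"
    and A: "\<And>i. i \<in> I \<Longrightarrow> A i \<in> sets M"
    and ei: "\<And>i. i \<in> I \<Longrightarrow> essential_image M N T (A i) (A' i)"
    and D: "essential_image M N T (\<Inter>i\<in>I. A i) D"
  shows "ae_subset N D (\<Inter>i\<in>I. A' i)"
proof -
  have Am: "(\<Inter>i\<in>I. A i) \<in> sets M" and A'm: "(\<Inter>i\<in>I. A' i) \<in> sets N"
    using A essential_image_sets[OF ei] I
    by (auto intro!: sets.countable_INT')
  have "AE x in M. \<forall>i\<in>I. x \<in> A i \<longrightarrow> T x \<in> A' i"
    using I(1) essential_image_AE[OF np ei A] by (simp add: AE_ball_countable)
  then have "AE x in M. x \<in> (\<Inter>i\<in>I. A i) \<longrightarrow> T x \<in> (\<Inter>i\<in>I. A' i)"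
    by eventually_elim auto
  then show ?thesis
    by (simp only: essential_image_adjunction[OF np D Am A'm]
        ae_subset_iff_AE[OF essential_image_sets[OF D] A'm])
qed

text \<open>Under the adjunction the two conditions say that, almost everywhere, \<open>A'\<close>
  lies inside \<open>M'\<close> and \<open>B'\<close> outside it. A separating set therefore exists
  exactly when \<open>A'\<close> and \<open>B'\<close> are disjoint up to a null set.\<close>

lemma essential_image_separation:
  assumes np: "null_preserving M N T"
    and A: "A \<in> sets M" "essential_image M N T A A'"
    and B: "B \<in> sets M" "essential_image M N T B B'"
  shows "(\<exists>M'\<in>sets N. ae_subset M A (T -` M' \<inter> space M) \<and>
             ae_subset M B (space M - (T -` M' \<inter> space M))) \<longleftrightarrow> ae_eq N (A' \<inter> B') {}"
proof -
  note T = null_preserving_measurable[OF np]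
  note A' = essential_image_sets[OF A(2)] and B' = essential_image_sets[OF B(2)]
  have 1: "ae_subset M A (T -` M' \<inter> space M) \<longleftrightarrow> (AE y in N. y \<in> A' \<longrightarrow> y \<in> M')"
    if "M' \<in> sets N" for M'
    using that by (simp add: ae_subset_vimage_iff_AE[OF T A(1)] essential_image_adjunction[OF np A(2,1)])
  have 2: "ae_subset M B (space M - (T -` M' \<inter> space M)) \<longleftrightarrow> (AE y in N. y \<in> B' \<longrightarrow> y \<notin> M')"
    if M': "M' \<in> sets N" for M'
  proof -
    have "space M - (T -` M' \<inter> space M) = T -` (space N - M') \<inter> space M"
      using measurable_space[OF T] by auto
    then have "ae_subset M B (space M - (T -` M' \<inter> space M)) \<longleftrightarrow>
        (AE y in N. y \<in> B' \<longrightarrow> y \<in> space N - M')"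
      using M' by (simp only: ae_subset_vimage_iff_AE[OF T B(1)]
          essential_image_adjunction[OF np B(2,1)] sets.compl_sets)
    also have "\<dots> \<longleftrightarrow> (AE y in N. y \<in> B' \<longrightarrow> y \<notin> M')"
      by (intro AE_cong) auto
    finally show ?thesis .
  qed
  have 3: "ae_eq N (A' \<inter> B') {} \<longleftrightarrow> (AE y in N. \<not> (y \<in> A' \<and> y \<in> B'))"
    using A' B' by (simp add: ae_eq_iff_AE)
  show ?thesis
  proof
    assume "\<exists>M'\<in>sets N. ae_subset M A (T -` M' \<inter> space M) \<and>
             ae_subset M B (space M - (T -` M' \<inter> space M))"
    then obtain M' where "AE y in N. y \<in> A' \<longrightarrow> y \<in> M'" "AE y in N. y \<in> B' \<longrightarrow> y \<notin> M'"
      using 1 2 by blast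
    then show "ae_eq N (A' \<inter> B') {}"
      unfolding 3 by eventually_elim auto
  next
    assume "ae_eq N (A' \<inter> B') {}"
    then have "AE y in N. y \<in> B' \<longrightarrow> y \<notin> A'"
      unfolding 3 by eventually_elim auto
    \<comment> \<open>\<open>A'\<close> itself serves as the separating set.\<close>
    with A' show "\<exists>M'\<in>sets N. ae_subset M A (T -` M' \<inter> space M) \<and>
             ae_subset M B (space M - (T -` M' \<inter> space M))"
      by (intro bexI[of _ A']) (simp_all add: 1 2)
  qed
qed

section \<open>Composition and iterates\<close>

lemma essential_image_comp:
  assumes np: "null_preserving M N T" and np': "null_preserving N P T'"
    and A: "A \<in> sets M" and ei: "essential_image M N T A A'" and ei': "essential_image N P T' A' A''"
  shows "essential_image M P (T' \<circ> T) A A''"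
proof (rule essential_imageI)
  note T = null_preserving_measurable[OF np] and T' = null_preserving_measurable[OF np']
  note A' = essential_image_sets[OF ei]
  show "T' \<circ> T \<in> measurable M P"
    using T T' by (rule measurable_comp)
  show "A \<in> sets M" by (rule A)
  show "A'' \<in> sets P"
    using ei' by (rule essential_image_sets)
  fix C assume C: "C \<in> sets P"
  \<comment> \<open>Adjoints compose: the adjunction for \<open>T\<close> is applied to the preimage
    of \<open>C\<close> under \<open>T'\<close>, then the one for \<open>T'\<close> to
    \<open>C\<close>.\<close>
  have "(AE x in M. x \<in> A \<longrightarrow> (T' \<circ> T) x \<in> C) \<longleftrightarrow>
      (AE x in M. x \<in> A \<longrightarrow> T x \<in> T' -` C \<inter> space N)"
    using measurable_space[OF T] by (intro AE_cong) auto
  also have "\<dots> \<longleftrightarrow> (AE y in N. y \<in> A' \<longrightarrow> y \<in> T' -` C \<inter> space N)"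
    using measurable_sets[OF T' C] by (rule essential_image_adjunction[OF np ei A])
  also have "\<dots> \<longleftrightarrow> (AE y in N. y \<in> A' \<longrightarrow> T' y \<in> C)"
    by (intro AE_cong) auto
  also have "\<dots> \<longleftrightarrow> (AE z in P. z \<in> A'' \<longrightarrow> z \<in> C)"
    by (rule essential_image_adjunction[OF np' ei' A' C])
  finally show "(AE x in M. x \<in> A \<longrightarrow> (T' \<circ> T) x \<in> C) \<longleftrightarrow> (AE z in P. z \<in> A'' \<longrightarrow> z \<in> C)" .
qed

lemma null_preserving_id: "null_preserving M M id"
  by (simp add: null_preserving_def absolutely_continuous_def id_def distr_id)

lemma null_preserving_comp:
  assumes np: "null_preserving M N T" and np': "null_preserving N P T'"
  shows "null_preserving M P (T' \<circ> T)"
proof -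
  note T = null_preserving_measurable[OF np] and T' = null_preserving_measurable[OF np']
  have "absolutely_continuous P (distr M P (T' \<circ> T))"
    unfolding absolutely_continuous_def
  proof
    fix Z assume Z: "Z \<in> null_sets P"
    have "AE x in M. (T' \<circ> T) x \<notin> Z"
      using null_preserving_AE[OF np null_preserving_AE[OF np' AE_not_in[OF Z]]] by simp
    then have "AE z in distr M P (T' \<circ> T). z \<notin> Z"
      using Z by (subst AE_distr_iff[OF measurable_comp[OF T T']]) auto
    then show "Z \<in> null_sets (distr M P (T' \<circ> T))"
      using Z by (subst AE_iff_null_sets) auto
  qed
  then show ?thesis
    using measurable_comp[OF T T'] by (simp add: null_preserving_def)
qed

lemma null_preserving_funpow: "null_preserving M M S \<Longrightarrow> null_preserving M M (S ^^ n)"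
  by (induction n) (auto intro: null_preserving_comp simp: null_preserving_id)

text \<open>Each iterate of the arbitrary selection \<open>Sh\<close> is an essential image, hence
  measurable, so the choice property covers the next application. The induction starts at the
  identity, under which \<open>A\<close> is its own essential image.\<close>

lemma essential_image_funpow:
  assumes np: "null_preserving M M S" and ch: "essential_image_choice M M S Sh" and A: "A \<in> sets M"
  shows "essential_image M M (S ^^ n) A ((Sh ^^ n) A)"
proof (induction n)
  case 0
  show ?case
    using A by (intro essential_imageI) auto
next
  case (Suc n)
  have "essential_image M M S ((Sh ^^ n) A) (Sh ((Sh ^^ n) A))"
    using ch essential_image_sets[OF Suc] by (simp add: essential_image_choice_def)
  from essential_image_comp[OF null_preserving_funpow[OF np] np A Suc this]
  show ?case by (simp add: o_def)
qed

section \<open>Change of the map and of the measures\<close>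

lemma essential_image_cong_AE:
  assumes np: "null_preserving M N T" and np': "null_preserving M N S"
    and A: "A \<in> sets M" and eq: "AE x in M. x \<in> A \<longrightarrow> T x = S x"
    and ei: "essential_image M N T A A'"
  shows "essential_image M N S A A'"
proof (rule essential_imageI[OF null_preserving_measurable[OF np'] A essential_image_sets[OF ei]])
  fix B' assume B': "B' \<in> sets N"
  \<comment> \<open>The map enters the adjunction only through its values at almost every point of
    \<open>A\<close>.\<close>
  have "(AE x in M. x \<in> A \<longrightarrow> S x \<in> B') \<longleftrightarrow> (AE x in M. x \<in> A \<longrightarrow> T x \<in> B')"
    using eq by (auto elim: eventually_elim2)
  then show "(AE x in M. x \<in> A \<longrightarrow> S x \<in> B') \<longleftrightarrow> (AE y in N. y \<in> A' \<longrightarrow> y \<in> B')"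
    by (simp add: essential_image_adjunction[OF np ei A B'])
qed

lemma equivalent_measures_null_sets: "equivalent_measures M N \<Longrightarrow> null_sets M = null_sets N"
  by (auto simp: equivalent_measures_def absolutely_continuous_def)

text \<open>The definition of an essential image sees a measure only through its space, its
  measurable sets and its null sets.\<close>

lemma essential_image_equivalent_measures:
  assumes M: "equivalent_measures M M2" and N: "equivalent_measures N N2"
  shows "essential_image M2 N2 T A A' \<longleftrightarrow> essential_image M N T A A'"
proof -
  have "sets M2 = sets M" "sets N2 = sets N"
    using M N by (auto simp: equivalent_measures_def)
  moreover from this have "space M2 = space M"
    by (auto dest: sets_eq_imp_space_eq)
  ultimately show ?thesis
    by (simp add: essential_image_def ae_subset_def
        equivalent_measures_null_sets[OF M, symmetric] equivalent_measures_null_sets[OF N, symmetric])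
qed

section \<open>Assembly of the calculus\<close>

theorem theorem3p1:
  fixes M :: "'a measure" and N :: "'b measure" and T :: "'a \<Rightarrow> 'b"
  assumes "sigma_finite_measure M" and "sigma_finite_measure N"
    and "null_preserving M N T"
  shows
    "\<comment> \<open>(i)\<close>
     (\<forall>A\<in>sets M.
        (\<exists>A'. essential_image M N T A A') \<and>
        {A'. essential_image M N T A A'} \<in> sets N // ae_eq_rel N) \<and>
     (\<forall>Th. essential_image_choice M N T Th \<longrightarrow>
        \<comment> \<open>(ii)\<close>
        (\<forall>A\<in>sets M. 0 < emeasure M A \<longleftrightarrow> 0 < emeasure N (Th A)) \<and>
        (\<forall>A'\<in>sets N. 0 < emeasure M (T -` A' \<inter> space M) \<longleftrightarrow>
                      0 < emeasure N (Th (space M) \<inter> A')) \<and>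
        \<comment> \<open>(iii)\<close>
        (\<forall>A\<in>sets M. \<forall>B\<in>sets M. ae_subset M A B \<longrightarrow> ae_subset N (Th A) (Th B)) \<and>
        (\<forall>A\<in>sets M. \<forall>B\<in>sets M. ae_eq M A B \<longrightarrow> ae_eq N (Th A) (Th B)) \<and>
        (\<forall>A\<in>sets M. \<forall>B'\<in>sets N.
           ae_subset M A (T -` B' \<inter> space M) \<longleftrightarrow> ae_subset N (Th A) B') \<and>
        (\<forall>A\<in>sets M. \<forall>B'\<in>sets N.
           ae_eq M A (T -` B' \<inter> space M) \<longrightarrow> ae_eq M A (T -` Th A \<inter> space M)) \<and>
        (\<forall>A'\<in>sets N. \<forall>B'\<in>sets N.
           ae_subset M (T -` A' \<inter> space M) (T -` B' \<inter> space M) \<longleftrightarrow>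
           ae_subset N (Th (space M) \<inter> A') (Th (space M) \<inter> B')) \<and>
        (\<forall>A\<in>sets M. \<forall>B\<in>sets M.
           (\<exists>M'\<in>sets N. ae_subset M A (T -` M' \<inter> space M) \<and>
                         ae_subset M B (space M - (T -` M' \<inter> space M))) \<longleftrightarrow>
           ae_eq N (Th A \<inter> Th B) {}) \<and>
        \<comment> \<open>(iv)\<close>
        (\<forall>A\<in>sets M. ae_subset M A (T -` Th A \<inter> space M)) \<and>
        (\<forall>B'\<in>sets N. ae_eq M (T -` (Th (space M) \<inter> B') \<inter> space M) (T -` B' \<inter> space M)) \<and>
        (\<forall>B'\<in>sets N. ae_eq N (Th (T -` B' \<inter> space M)) (Th (space M) \<inter> B')) \<and>
        (\<forall>A\<in>sets M. \<forall>B'\<in>sets N.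
           ae_eq N (Th (A \<inter> (T -` B' \<inter> space M))) (Th A \<inter> B')) \<and>
        \<comment> \<open>(v)\<close>
        (\<forall>A :: nat \<Rightarrow> 'a set. (\<forall>n\<ge>1. A n \<in> sets M) \<longrightarrow>
           ae_eq N (Th (\<Union>n\<in>{1..}. A n)) (\<Union>n\<in>{1..}. Th (A n)) \<and>
           ae_subset N (Th (\<Inter>n\<in>{1..}. A n)) (\<Inter>n\<in>{1..}. Th (A n))) \<and>
        \<comment> \<open>(vi), composition\<close>
        (\<forall>(P :: 'c measure) T' Th' Thc.
           sigma_finite_measure P \<and> null_preserving N P T' \<and>
           essential_image_choice N P T' Th' \<and>
           essential_image_choice M P (T' \<circ> T) Thc \<longrightarrow>
           (\<forall>A\<in>sets M. ae_eq P (Thc A) (Th' (Th A)))) \<and>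
        \<comment> \<open>(vii)\<close>
        (\<forall>To Tho. null_preserving M N To \<and> essential_image_choice M N To Tho \<longrightarrow>
           (\<forall>A\<in>sets M. (AE x in M. x \<in> A \<longrightarrow> T x = To x) \<longrightarrow> ae_eq N (Th A) (Tho A)) \<and>
           ((AE x in M. T x = To x) \<longrightarrow> (\<forall>A\<in>sets M. ae_eq N (Th A) (Tho A)))) \<and>
        \<comment> \<open>(ix)\<close>
        (\<forall>u v. u \<in> borel_measurable M \<and> (\<forall>x\<in>space M. 0 \<le> u x) \<and>
           transfer_version M N T u v \<longrightarrow>
           ae_eq N (Th {x \<in> space M. 0 < u x}) {y \<in> space N. 0 < v y})) \<and>
     \<comment> \<open>(vi), iterates of a self-map\<close>
     (\<forall>(S :: 'a \<Rightarrow> 'a) Sh n Snh.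
        null_preserving M M S \<and> essential_image_choice M M S Sh \<and>
        1 \<le> n \<and> essential_image_choice M M (S ^^ n) Snh \<longrightarrow>
        (\<forall>A\<in>sets M. ae_eq M (Snh A) ((Sh ^^ n) A))) \<and>
     \<comment> \<open>(viii)\<close>
     (\<forall>M2 N2. sigma_finite_measure M2 \<and> sigma_finite_measure N2 \<and>
        equivalent_measures M M2 \<and> equivalent_measures N N2 \<longrightarrow>
        (\<forall>A\<in>sets M. {A'. essential_image M2 N2 T A A'} = {A'. essential_image M N T A A'}))"
proof (intro conjI ballI allI impI)
  note np = assms(3)
  show "\<exists>A'. essential_image M N T A A'" if "A \<in> sets M" for A
    using assms(2) np that by (rule essential_image_exists)
  show "{A'. essential_image M N T A A'} \<in> sets N // ae_eq_rel N" if "A \<in> sets M" for A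
    using assms(2) np that by (rule essential_images_quotient)
  show "ae_eq M (Snh A) ((Sh ^^ n) A)"
    if "null_preserving M M S \<and> essential_image_choice M M S Sh \<and>
      1 \<le> n \<and> essential_image_choice M M (S ^^ n) Snh" "A \<in> sets M" for S Sh n Snh A
    using that essential_image_funpow[of M S Sh A n]
    by (auto simp: essential_image_choice_def intro: essential_image_unique)
  show "{A'. essential_image M2 N2 T A A'} = {A'. essential_image M N T A A'}"
    if "sigma_finite_measure M2 \<and> sigma_finite_measure N2 \<and>
      equivalent_measures M M2 \<and> equivalent_measures N N2" for M2 N2 A
    using that essential_image_equivalent_measures by blast
next
  \<comment> \<open>The remaining goals concern one arbitrary selection \<open>Th\<close>. Several
    equalities follow from \<open>uniq\<close>, once the right side is recognised as an essential
    image of the set to which \<open>Th\<close> is applied.\<close>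
  fix Th assume "essential_image_choice M N T Th"
  then have ei: "essential_image M N T A (Th A)" if "A \<in> sets M" for A
    using that by (simp add: essential_image_choice_def)
  note np = assms(3)
  note T = null_preserving_measurable[OF np]
  note Tv = measurable_sets[OF T]
  note Ths = essential_image_sets[OF ei]
  note eiX = ei[OF sets.top]
  note uniq = essential_image_unique[OF ei]
  show "0 < emeasure M A \<longleftrightarrow> 0 < emeasure N (Th A)" if "A \<in> sets M" for A
    using essential_image_pos_iff[OF np ei[OF that] that] .
  show "0 < emeasure M (T -` A' \<inter> space M) \<longleftrightarrow> 0 < emeasure N (Th (space M) \<inter> A')"
    if "A' \<in> sets N" for A'
    using essential_image_pos_iff[OF np essential_image_vimage[OF np eiX that] Tv[OF that]] .
  show mono: "ae_subset N (Th A) (Th B)"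
    if "A \<in> sets M" "B \<in> sets M" "ae_subset M A B" for A B
    using essential_image_mono[OF np that(1) ei[OF that(1)] that(2) ei[OF that(2)] that(3)] .
  show "ae_eq N (Th A) (Th B)" if "A \<in> sets M" "B \<in> sets M" "ae_eq M A B" for A B
    using that by (simp add: ae_eq_iff_ae_subset mono Ths)
  show adj: "ae_subset M A (T -` B' \<inter> space M) \<longleftrightarrow> ae_subset N (Th A) B'"
    if "A \<in> sets M" "B' \<in> sets N" for A B'
    using essential_image_adjunction[OF np ei[OF that(1)] that]
    by (simp add: ae_subset_vimage_iff_AE[OF T that] ae_subset_iff_AE Ths that)
  show unit: "ae_subset M A (T -` Th A \<inter> space M)" if "A \<in> sets M" for A
    using ei[OF that] by (simp add: essential_image_def)
  show "ae_eq M A (T -` Th A \<inter> space M)"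
    if A: "A \<in> sets M" and B': "B' \<in> sets N" and eq: "ae_eq M A (T -` B' \<inter> space M)" for A B'
  proof -
    have eqA: "AE x in M. x \<in> A \<longleftrightarrow> x \<in> T -` B' \<inter> space M"
      using eq A Tv[OF B'] by (simp only: ae_eq_iff_AE)
    \<comment> \<open>Since the preimage of \<open>B'\<close> covers \<open>A\<close>, the
      adjunction places \<open>Th A\<close> in \<open>B'\<close>. Pulling this back along
      \<open>T\<close> puts the preimage of \<open>Th A\<close> inside that of \<open>B'\<close>,
      which is \<open>A\<close> up to a null set.\<close>
    have "ae_subset N (Th A) B'"
      using eq by (simp add: adj[OF A B', symmetric] ae_eq_iff_ae_subset A Tv[OF B'])
    then have "AE x in M. T x \<in> Th A \<longrightarrow> T x \<in> B'"
      by (intro null_preserving_AE[OF np]) (simp add: ae_subset_iff_AE Ths[OF A] B')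
    with eqA essential_image_AE[OF np ei[OF A] A]
    have "AE x in M. x \<in> A \<longleftrightarrow> x \<in> T -` Th A \<inter> space M"
      using AE_space[of M] by eventually_elim auto
    then show ?thesis
      by (simp only: ae_eq_iff_AE A Tv[OF Ths[OF A]])
  qed
  show "ae_subset M (T -` A' \<inter> space M) (T -` B' \<inter> space M) \<longleftrightarrow>
      ae_subset N (Th (space M) \<inter> A') (Th (space M) \<inter> B')"
    if A': "A' \<in> sets N" and B': "B' \<in> sets N" for A' B'
  proof -
    note eA = essential_image_vimage[OF np eiX A']
    have "ae_subset M (T -` A' \<inter> space M) (T -` B' \<inter> space M) \<longleftrightarrow>
        ae_subset N (Th (space M) \<inter> A') B'"
      using essential_image_adjunction[OF np eA Tv[OF A'] B']
      by (simp only: ae_subset_vimage_iff_AE[OF T Tv[OF A'] B']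
          ae_subset_iff_AE[OF essential_image_sets[OF eA] B'])
    \<comment> \<open>The two set differences are literally equal, because
      \<open>Th (space M)\<close> already bounds the left side.\<close>
    also have "\<dots> \<longleftrightarrow> ae_subset N (Th (space M) \<inter> A') (Th (space M) \<inter> B')"
      unfolding ae_subset_def by (rule arg_cong[where f = "\<lambda>Z. Z \<in> null_sets N"]) auto
    finally show ?thesis .
  qed
  show "(\<exists>M'\<in>sets N. ae_subset M A (T -` M' \<inter> space M) \<and>
        ae_subset M B (space M - (T -` M' \<inter> space M))) \<longleftrightarrow> ae_eq N (Th A \<inter> Th B) {}"
    if "A \<in> sets M" "B \<in> sets M" for A B
    using essential_image_separation[OF np that(1) ei[OF that(1)] that(2) ei[OF that(2)]] .
  show "ae_eq M (T -` (Th (space M) \<inter> B') \<inter> space M) (T -` B' \<inter> space M)"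
    if B': "B' \<in> sets N" for B'
  proof -
    \<comment> \<open>Almost every point is mapped into \<open>Th (space M)\<close>, so the
      intersection changes the preimage only by a null set.\<close>
    have "AE x in M. x \<in> T -` (Th (space M) \<inter> B') \<inter> space M \<longleftrightarrow> x \<in> T -` B' \<inter> space M"
      using essential_image_AE[OF np eiX sets.top] by eventually_elim auto
    then show ?thesis
      using Tv[OF B'] Tv[OF sets.Int[OF Ths[OF sets.top] B']] by (simp only: ae_eq_iff_AE)
  qed
  show "ae_eq N (Th (T -` B' \<inter> space M)) (Th (space M) \<inter> B')" if "B' \<in> sets N" for B'
    using uniq[OF Tv[OF that] essential_image_vimage[OF np eiX that]] .
  show "ae_eq N (Th (A \<inter> (T -` B' \<inter> space M))) (Th A \<inter> B')"
    if "A \<in> sets M" "B' \<in> sets N" for A B'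
    using uniq[OF sets.Int[OF that(1) Tv[OF that(2)]]
        essential_image_Int_vimage[OF np ei[OF that(1)] that]] .
  show "ae_eq N (Th (\<Union>n\<in>{1..}. A n)) (\<Union>n\<in>{1..}. Th (A n))"
    if "\<forall>n\<ge>1. A n \<in> sets M" for A :: "nat \<Rightarrow> 'a set"
    using that by (intro uniq essential_image_UN[OF np] ei) auto
  show "ae_subset N (Th (\<Inter>n\<in>{1..}. A n)) (\<Inter>n\<in>{1..}. Th (A n))"
    if "\<forall>n\<ge>1. A n \<in> sets M" for A :: "nat \<Rightarrow> 'a set"
    using that
    by (intro essential_image_INT_subset[OF np, where A = A] ei) (auto intro!: sets.countable_INT')
  \<comment> \<open>\<open>Th A\<close> is measurable, so \<open>Th'\<close> picks a genuine
    essential image of it; both sides are then essential images of \<open>A\<close> under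
    \<open>T' \<circ> T\<close>.\<close>
  show "ae_eq P (Thc A) (Th' (Th A))"
    if "sigma_finite_measure P \<and> null_preserving N P T' \<and> essential_image_choice N P T' Th' \<and>
        essential_image_choice M P (T' \<circ> T) Thc" "A \<in> sets M"
    for P :: "'c measure" and T' Th' Thc A
    using that Ths[OF that(2)] essential_image_comp[OF np _ that(2) ei[OF that(2)]]
    by (auto simp: essential_image_choice_def intro!: essential_image_unique[of M P "T' \<circ> T" A])
  show vii: "ae_eq N (Th A) (Tho A)"
    if "null_preserving M N To \<and> essential_image_choice M N To Tho" "A \<in> sets M"
      "AE x in M. x \<in> A \<longrightarrow> T x = To x" for To Tho A
    using that essential_image_cong_AE[OF np _ that(2,3) ei[OF that(2)]]
    by (auto simp: essential_image_choice_def intro: essential_image_unique)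
  show "ae_eq N (Th A) (Tho A)"
    if "null_preserving M N To \<and> essential_image_choice M N To Tho"
      "AE x in M. T x = To x" "A \<in> sets M" for To Tho A
    using that(2) by (intro vii[OF that(1,3)]) (auto elim: eventually_mono)
  show "ae_eq N (Th {x \<in> space M. 0 < u x}) {y \<in> space N. 0 < v y}"
    if "u \<in> borel_measurable M \<and> (\<forall>x\<in>space M. 0 \<le> u x) \<and> transfer_version M N T u v" for u v
    using that by (intro uniq essential_image_transfer[OF np]) auto
qed

end
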